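(* Let $\theta\in[1/2,1]$, and suppose the adjacent time-step ratios satisfy $0<r_k\le r_s$ for all $k\ge 2$, where $r_s=r_s(\theta)$. Then for any real sequence $\{\omega_k\}_{k=1}^n$, $$2\omega_k\sum_{j=1}^k b_{k-j}^{(k)}\omega_j\;\ge\;\frac{(2\theta-1)r_{k+1}^{3/2}}{1+r_{k+1}}\,\frac{\omega_k^2}{\tau_k}-\frac{(2\theta-1)r_k^{3/2}}{1+r_k}\,\frac{\omega_{k-1}^2}{\tau_{k-1}}\qquad\text{for all } 2\le k\le n .$$ Consequently the discrete convolution kernels $b^{(n)}_{n-k}$ are positive semi-definite, i.e. $$\sum_{k=1}^n\omega_k\sum_{j=1}^k b_{k-j}^{(k)}\omega_j\ge 0 .$$
   Context: Let $0=t_0<t_1<\cdots<t_N=T$ be a nonuniform time grid with steps $\tau_k=t_k-t_{k-1}>0$ ($1\le k\le N$) and adjacent step ratios $r_k=\tau_k/\tau_{k-1}$ ($2\le k\le N$); $n$ ranges over $1\le n\le N$. The quantity $r_{N+1}$, which appears only when $k=n=N$, denotes any fixed number in $(0,r_s]$ (finite). For $\theta\in[1/2,1]$ the WSBDF2 discrete convolution kernels are $b_0^{(1)}=1/\tau_1$ and, for $n\ge2$, $$b_0^{(n)}=\frac{1+2\theta r_n}{\tau_n(1+r_n)},\qquad b_1^{(n)}=\frac{(1-2\theta)r_n^2}{\tau_n(1+r_n)},\qquad b_j^{(n)}=0\ \ (2\le j\le n-1).$$ For $\theta\in(1/2,1]$, $$r_s=\frac{4\theta^2-\sqrt[3]{-4\theta^2E+3(1-2\theta)^2\frac{-F+\sqrt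 G}{2}}-\sqrt[3]{-4\theta^2E+3(1-2\theta)^2\frac{-F-\sqrt G}{2}}}{3(1-2\theta)^2},$$ with $E=16\theta^4+48\theta^3-48\theta^2+12\theta$, $F=16\theta^3+36\theta^2-36\theta+9$, $G=384\theta^5+912\theta^4-2496\theta^3+1944\theta^2-648\theta+81$ (real cube roots); equivalently, $r_s$ is the positive root of $(1-2\theta)^2r^3-4\theta^2r^2-4\theta r-1=0$. For $\theta=1/2$, $r_s=\infty$ (no upper restriction on the ratios). *)

theory Defs
  imports Complex_Main "HOL-Library.Extended_Real"
begin

text \<open>The kernels $b_j^{(n)}$; only the indices $0 \le j \le n - 1$ are meaningful.\<close>

definition wsbdf2_kernel ::
    "real \<Rightarrow> (nat \<Rightarrow> real) \<Rightarrow> (nat \<Rightarrow> real) \<Rightarrow> nat \<Rightarrow> nat \<Rightarrow> real" where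
  "wsbdf2_kernel \<theta> \<tau> r n j =
    (if n = 1 then (if j = 0 then 1 / \<tau> 1 else 0)
     else if j = 0 then (1 + 2 * \<theta> * r n) / (\<tau> n * (1 + r n))
     else if j = 1 then (1 - 2 * \<theta>) * (r n)\<^sup>2 / (\<tau> n * (1 + r n))
     else 0)"

definition E_coeff :: "real \<Rightarrow> real" where
  "E_coeff \<theta> = 16 * \<theta>^4 + 48 * \<theta>^3 - 48 * \<theta>^2 + 12 * \<theta>"

definition F_coeff :: "real \<Rightarrow> real" where
  "F_coeff \<theta> = 16 * \<theta>^3 + 36 * \<theta>^2 - 36 * \<theta> + 9"

definition G_coeff :: "real \<Rightarrow> real" where
  "G_coeff \<theta> =
    384 * \<theta>^5 + 912 * \<theta>^4 - 2496 * \<theta>^3 + 1944 * \<theta>^2 - 648 * \<theta> + 81"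

text \<open>For $1/2 < \theta \le 1$ this is the root formula for the unique positive root of
  $(1 - 2\theta)^2 r^3 - 4\theta^2 r^2 - 4\theta r - 1 = 0$. The radicands of the cube roots are
  negative, so it matters that \<^term>\<open>root 3\<close> is the odd real root; and
  \<^term>\<open>G_coeff \<theta>\<close> is positive, since with $e = 2\theta - 1$ it equals
  $96\theta^3 e^2 + 81 e^4$. For $\theta = 1/2$ the value $\infty$ encodes that the step ratios
  are unrestricted.\<close>

definition ratio_bound :: "real \<Rightarrow> ereal" where
  "ratio_bound \<theta> =
    (if \<theta> = 1/2 then \<infinity>
     else ereal
       ((4 * \<theta>^2
          - root 3 (- 4 * \<theta>^2 * E_coeff \<theta>
              + 3 * (1 - 2 * \<theta>)^2 * ((- F_coeff \<theta> + sqrt (G_coeff \<theta>)) / 2))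
          - root 3 (- 4 * \<theta>^2 * E_coeff \<theta>
              + 3 * (1 - 2 * \<theta>)^2 * ((- F_coeff \<theta> - sqrt (G_coeff \<theta>)) / 2)))
        / (3 * (1 - 2 * \<theta>)^2)))"

end

theory Submission
  imports Defs
begin

text \<open>Write $W(x) = (2\theta - 1) x^{3/2} / (1 + x)$. For $k \ge 2$ only two kernels are nonzero,
  so $2 \omega_k \sum_j b_{k-j}^{(k)} \omega_j$ is a multiple of $\omega_k^2$ plus a cross term in
  $\omega_k \omega_{k-1}$. Young's inequality, weighted so that the $\omega_{k-1}^2$ part is exactly
  $W(r_k) \omega_{k-1}^2 / \tau_{k-1}$, costs $W(r_k) \omega_k^2 / \tau_k$ on the diagonal
  (\<open>weighted_young\<close>). What remains is
  $$W(r_k) + W(r_{k+1}) \le \frac{2 (1 + 2\theta r_k)}{1 + r_k}$$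
  (\<open>ratio_weight_sum_le\<close>). For $\theta = 1/2$ the weight $W$ vanishes.
  For $\theta > 1/2$ and $r_k = r_{k+1} = r_s$ this is an equality: after squaring it says
  $(1 + 2\theta r_s)^2 = (2\theta - 1)^2 r_s^3$, which is the cubic equation of $r_s$
  (\<open>ratio_bound_root\<close>). Monotonicity of $W$ in $r_{k+1}$ and concavity in $r_k$ carry it to all
  smaller ratios.

  The right-hand sides telescope in $k$, leaving only $- W(r_2) \omega_1^2 / \tau_1$ as a negative
  contribution, and the first kernel supplies $2 \omega_1^2 / \tau_1$, which is enough because
  $W \le 2$ on the admissible ratios.\<close>

section \<open>The ratio bound as a root of a cubic\<close>

text \<open>This is Cardano's formula in Shengjin's form; up to a factor, $A$, $B$, $C$ are the
  coefficients of the Hessian of the cubic, and $D$ is a negative multiple of its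
  discriminant. The substitution $z = 3 a x + b$ turns the cubic into
  $z^3 - 3 A z + (2 A b - 3 a B) = 0$; the two radicands have sum $2 A b - 3 a B$ and product $A^3$,
  so $z = -(p + q)$ with $p^3, q^3$ the radicands and $p q = A$ solves it.\<close>

lemma shengjin_cubic_root:
  fixes a b c d :: real
  defines "A \<equiv> b\<^sup>2 - 3 * a * c" and "B \<equiv> b * c - 9 * a * d" and "C \<equiv> c\<^sup>2 - 3 * b * d"
  defines "D \<equiv> B\<^sup>2 - 4 * A * C"
  defines "x \<equiv> (- b - root 3 (A * b + 3 * a * ((- B + sqrt D) / 2))
                    - root 3 (A * b + 3 * a * ((- B - sqrt D) / 2))) / (3 * a)"
  assumes a: "a \<noteq> 0" and D: "D \<ge> 0"
  shows "a * x^3 + b * x\<^sup>2 + c * x + d = 0"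
proof -
  define u where "u = A * b + 3 * a * ((- B + sqrt D) / 2)"
  define v where "v = A * b + 3 * a * ((- B - sqrt D) / 2)"
  define p where "p = root 3 u"
  define q where "q = root 3 v"
  have p3: "p^3 = u" and q3: "q^3 = v"
    by (simp_all add: p_def q_def odd_real_root_pow)
  have sq: "(sqrt D)\<^sup>2 = D" using D by simp
  have "u * v = A\<^sup>2 * b\<^sup>2 - 3 * a * A * b * B + 9 * a\<^sup>2 * (B\<^sup>2 - (sqrt D)\<^sup>2) / 4"
    unfolding u_def v_def by (simp add: field_simps power2_eq_square)
  also have "\<dots> = A^3"
    unfolding sq unfolding D_def A_def B_def C_def by algebra
  finally have "(p * q)^3 = A^3" by (simp add: power_mult_distrib p3 q3)
  then have pq: "p * q = A" using odd_real_root_power_cancel[of 3] by (metis odd_numeral)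
  have uv: "u + v = 2 * A * b - 3 * a * B"
    unfolding u_def v_def by (simp add: field_simps)
  define z where "z = - (p + q)"
  have "z^3 = - (p^3 + q^3) + 3 * (p * q) * z"
    unfolding z_def by algebra
  then have depressed: "z^3 - 3 * A * z + (2 * A * b - 3 * a * B) = 0"
    using uv by (simp add: p3 q3 pq)
  have "3 * a * x = z - b"
    using a by (simp add: x_def z_def p_def q_def u_def v_def)
  then have z: "z = 3 * a * x + b" by simp
  have "27 * a\<^sup>2 * (a * x^3 + b * x\<^sup>2 + c * x + d) = z^3 - 3 * A * z + (2 * A * b - 3 * a * B)"
    unfolding z A_def B_def by algebra
  with depressed a show ?thesis by simp
qed

lemma ratio_bound_root:
  assumes "\<theta> \<noteq> 1/2" and "0 \<le> \<theta>"
  obtains s where "ratio_bound \<theta> = ereal s"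
    and "(1 - 2 * \<theta>)\<^sup>2 * s^3 - 4 * \<theta>\<^sup>2 * s\<^sup>2 - 4 * \<theta> * s - 1 = 0"
proof -
  define e where "e = (1 - 2 * \<theta>)\<^sup>2"
  have e: "e \<noteq> 0" using assms by (simp add: e_def)
  have E: "(- (4 * \<theta>\<^sup>2))\<^sup>2 - 3 * e * (- (4 * \<theta>)) = E_coeff \<theta>"
    unfolding E_coeff_def e_def by algebra
  have F: "- (4 * \<theta>\<^sup>2) * (- (4 * \<theta>)) - 9 * e * (- 1) = F_coeff \<theta>"
    unfolding F_coeff_def e_def by algebra
  have G: "(F_coeff \<theta>)\<^sup>2 - 4 * E_coeff \<theta> * ((- (4 * \<theta>))\<^sup>2 - 3 * (- (4 * \<theta>\<^sup>2)) * (- 1)) = G_coeff \<theta>"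
    unfolding F_coeff_def E_coeff_def G_coeff_def by algebra
  have "G_coeff \<theta> = 96 * \<theta>^3 * e + 81 * e\<^sup>2"
    unfolding G_coeff_def e_def by algebra
  also have "\<dots> \<ge> 0" using assms by (simp add: e_def)
  finally have Gnn: "G_coeff \<theta> \<ge> 0" .
  define s where "s = (4 * \<theta>^2
          - root 3 (- 4 * \<theta>^2 * E_coeff \<theta> + 3 * e * ((- F_coeff \<theta> + sqrt (G_coeff \<theta>)) / 2))
          - root 3 (- 4 * \<theta>^2 * E_coeff \<theta> + 3 * e * ((- F_coeff \<theta> - sqrt (G_coeff \<theta>)) / 2)))
        / (3 * e)"
  have "e * s^3 + (- (4 * \<theta>\<^sup>2)) * s\<^sup>2 + (- (4 * \<theta>)) * s + (- 1) = 0"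
    using shengjin_cubic_root[of e "- (4 * \<theta>\<^sup>2)" "- (4 * \<theta>)" "- 1", OF e, unfolded E F G] Gnn
    by (simp add: s_def mult.commute)
  moreover have "ratio_bound \<theta> = ereal s"
    using assms by (simp add: ratio_bound_def s_def e_def)
  ultimately show thesis using that by (simp add: e_def)
qed

section \<open>The boundary weight\<close>

definition ratio_weight :: "real \<Rightarrow> real \<Rightarrow> real" where
  "ratio_weight \<theta> x = (2 * \<theta> - 1) * x powr (3/2) / (1 + x)"

lemma powr_three_halves:
  fixes x :: real
  assumes "0 \<le> x"
  shows "x powr (3/2) = x * sqrt x"
proof -
  have "x powr (3/2) = x powr (1 + 1/2)" by simp
  then show ?thesis using assms by (simp only: powr_add powr_half_sqrt) simp
qed

lemma ratio_weight_nonneg: "1/2 \<le> \<theta> \<Longrightarrow> 0 \<le> x \<Longrightarrow> 0 \<le> ratio_weight \<theta> x"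
  by (simp add: ratio_weight_def)

lemma ratio_weight_mono:
  assumes "1/2 \<le> \<theta>" "0 \<le> x" "x \<le> y"
  shows "ratio_weight \<theta> x \<le> ratio_weight \<theta> y"
proof -
  have "x * sqrt x \<le> y * sqrt y" and "x * y * sqrt x \<le> x * y * sqrt y"
    using assms by (auto intro!: mult_mono)
  then have "x * sqrt x * (1 + y) \<le> y * sqrt y * (1 + x)"
    by (simp add: algebra_simps)
  then have "x * sqrt x / (1 + x) \<le> y * sqrt y / (1 + y)"
    using assms by (simp add: divide_le_eq pos_le_divide_eq field_simps)
  then have "(2 * \<theta> - 1) * (x * sqrt x / (1 + x)) \<le> (2 * \<theta> - 1) * (y * sqrt y / (1 + y))"
    using assms by (intro mult_left_mono) auto
  then show ?thesis
    using assms by (simp add: ratio_weight_def powr_three_halves)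
qed

text \<open>The square root of the cubic equation: both $1 + 2\theta s$ and $(2\theta - 1) s^{3/2}$ are
  nonnegative, and the cubic says that their squares agree.\<close>

lemma ratio_weight_at_root:
  assumes "1/2 \<le> \<theta>" "0 < s"
    and cubic: "(1 - 2 * \<theta>)\<^sup>2 * s^3 - 4 * \<theta>\<^sup>2 * s\<^sup>2 - 4 * \<theta> * s - 1 = 0"
  shows "(2 * \<theta> - 1) * (s * sqrt s) = 1 + 2 * \<theta> * s"
    and "ratio_weight \<theta> s = (1 + 2 * \<theta> * s) / (1 + s)"
proof -
  have "((2 * \<theta> - 1) * (s * sqrt s))\<^sup>2 = (2 * \<theta> - 1)\<^sup>2 * s\<^sup>2 * (sqrt s)\<^sup>2"
    by (simp add: power_mult_distrib)
  also have "\<dots> = (1 - 2 * \<theta>)\<^sup>2 * s^3"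
    using assms(2) by (simp add: power2_eq_square power3_eq_cube algebra_simps)
  also have "\<dots> = (1 + 2 * \<theta> * s)\<^sup>2"
    using cubic by (simp add: power2_eq_square algebra_simps)
  finally show eq: "(2 * \<theta> - 1) * (s * sqrt s) = 1 + 2 * \<theta> * s"
    using assms(1,2) by (simp add: power2_eq_iff_nonneg)
  show "ratio_weight \<theta> s = (1 + 2 * \<theta> * s) / (1 + s)"
    using assms(2) eq by (simp add: ratio_weight_def powr_three_halves)
qed

text \<open>For $\theta = 1/2$ the weight vanishes. Otherwise the bound is a root $s > 0$ of the cubic.
  Monotonicity reduces the claim to $y = s$; there, multiplied by $1 + x$, it says that a concave
  function of $x$ is nonnegative on $[0, s]$. It vanishes at $s$, and at $0$ it equals
  $2 - (1 + 2\theta s)/(1 + s) \ge 0$ since $\theta \le 1$. Replacing $x^{3/2}$ by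
  the larger $x \sqrt s$ gives its chord: affine in $x$, with the same endpoint values.\<close>

lemma ratio_weight_sum_le:
  assumes \<theta>: "1/2 \<le> \<theta>" "\<theta> \<le> 1"
    and x: "0 < x" "ereal x \<le> ratio_bound \<theta>"
    and y: "0 < y" "ereal y \<le> ratio_bound \<theta>"
  shows "ratio_weight \<theta> x + ratio_weight \<theta> y \<le> 2 * (1 + 2 * \<theta> * x) / (1 + x)"
proof (cases "\<theta> = 1/2")
  case True
  then have "ratio_weight \<theta> z = 0" for z by (simp add: ratio_weight_def)
  then show ?thesis using \<theta> x by simp
next
  case False
  then obtain s where s: "ratio_bound \<theta> = ereal s"
    and cubic: "(1 - 2 * \<theta>)\<^sup>2 * s^3 - 4 * \<theta>\<^sup>2 * s\<^sup>2 - 4 * \<theta> * s - 1 = 0"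
    using \<theta> by (elim ratio_bound_root) auto
  have xs: "x \<le> s" and ys: "y \<le> s" using x y s by auto
  have s0: "0 < s" using x xs by simp
  note root = ratio_weight_at_root[OF \<theta>(1) s0 cubic]
  define K where "K = (1 + 2 * \<theta> * s) / (1 + s)"
  have yK: "ratio_weight \<theta> y \<le> K"
    using ratio_weight_mono[OF \<theta>(1) _ ys] y root(2) by (simp add: K_def)
  have Ks: "K * (1 + s) = 1 + 2 * \<theta> * s" using s0 by (simp add: K_def)
  have "\<theta> * s \<le> s" using \<theta> s0 by simp
  then have "1 + 2 * \<theta> * s \<le> 2 * (1 + s)" by simp
  then have K2: "K \<le> 2" unfolding K_def using s0 by (subst pos_divide_le_eq) auto
  \<comment> \<open>The chord is \<open>2 - K\<close> at $0$ and vanishes at $s$, hence equals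
      \<open>(2 - K) * (s - x) / s\<close>.\<close>
  have "s * (2 * (1 + 2 * \<theta> * x) - (2 * \<theta> - 1) * (x * sqrt s) - K * (1 + x))
      = 2 * s + 4 * \<theta> * s * x - x * ((2 * \<theta> - 1) * (s * sqrt s)) - s * K - x * (K * s)"
    by (simp add: algebra_simps)
  also have "K * s = 1 + 2 * \<theta> * s - K" using Ks by (simp add: algebra_simps)
  also have "2 * s + 4 * \<theta> * s * x - x * ((2 * \<theta> - 1) * (s * sqrt s)) - s * K
        - x * (1 + 2 * \<theta> * s - K) = (2 - K) * (s - x)"
    unfolding root(1) by (simp add: algebra_simps)
  also have "\<dots> \<ge> 0" using K2 xs by simp
  finally have affine:
    "0 \<le> 2 * (1 + 2 * \<theta> * x) - (2 * \<theta> - 1) * (x * sqrt s) - K * (1 + x)"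
    using s0 by (simp add: zero_le_mult_iff)
  have "(2 * \<theta> - 1) * (x * sqrt x) \<le> (2 * \<theta> - 1) * (x * sqrt s)"
    using \<theta> x xs by (intro mult_left_mono) auto
  with affine have "(2 * \<theta> - 1) * (x * sqrt x) + K * (1 + x) \<le> 2 * (1 + 2 * \<theta> * x)"
    by simp
  then have "((2 * \<theta> - 1) * (x * sqrt x) + K * (1 + x)) / (1 + x) \<le> 2 * (1 + 2 * \<theta> * x) / (1 + x)"
    using x by (intro divide_right_mono) auto
  then have "ratio_weight \<theta> x + K \<le> 2 * (1 + 2 * \<theta> * x) / (1 + x)"
    using x by (simp add: ratio_weight_def powr_three_halves add_divide_distrib)
  with yK show ?thesis by simp
qed

lemma ratio_weight_le_2:
  assumes \<theta>: "1/2 \<le> \<theta>" "\<theta> \<le> 1" and x: "0 < x" "ereal x \<le> ratio_bound \<theta>"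
  shows "ratio_weight \<theta> x \<le> 2"
proof -
  have "\<theta> * x \<le> x" using \<theta> x by simp
  then have "4 * (\<theta> * x) \<le> 4 * x" by simp
  then have "4 * (\<theta> * x) \<le> 2 + 4 * x" using x by linarith
  then have "2 * (1 + 2 * \<theta> * x) / (1 + x) \<le> 4" using x by (simp add: pos_divide_le_eq)
  with ratio_weight_sum_le[OF \<theta> x x] show ?thesis by simp
qed

section \<open>The kernel inequality\<close>

text \<open>Completing the square in $x^{3/4} a - x^{5/4} b$; the weights make the coefficient of $b^2$
  equal to $x$ times that of $a^2$, which matches $\tau_k / \tau_{k-1} = x$.\<close>

lemma weighted_young:
  fixes x a b :: real
  assumes "0 \<le> x"
  shows "2 * x\<^sup>2 * (a * b) \<le> x powr (3/2) * (a\<^sup>2 + x * b\<^sup>2)"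
proof -
  define u where "u = sqrt x"
  have u: "0 \<le> u" "x = u\<^sup>2" using assms by (simp_all add: u_def)
  have "x powr (3/2) * (a\<^sup>2 + x * b\<^sup>2) - 2 * x\<^sup>2 * (a * b) = u^3 * (a - u * b)\<^sup>2"
    unfolding powr_three_halves[OF assms] using u
    by (simp add: eval_nat_numeral algebra_simps)
  moreover have "0 \<le> u^3 * (a - u * b)\<^sup>2" using u by simp
  ultimately show ?thesis by linarith
qed

lemma wsbdf2_sum:
  assumes "2 \<le> k"
  shows "(\<Sum>j=1..k. wsbdf2_kernel \<theta> \<tau> r k (k - j) * \<omega> j)
    = ((1 + 2 * \<theta> * r k) * \<omega> k - (2 * \<theta> - 1) * (r k)\<^sup>2 * \<omega> (k - 1)) / (\<tau> k * (1 + r k))"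
proof -
  have "(\<Sum>j=1..k. wsbdf2_kernel \<theta> \<tau> r k (k - j) * \<omega> j)
      = (\<Sum>j\<in>{k - 1, k}. wsbdf2_kernel \<theta> \<tau> r k (k - j) * \<omega> j)"
    using assms by (intro sum.mono_neutral_right) (auto simp: wsbdf2_kernel_def)
  also have "\<dots> = wsbdf2_kernel \<theta> \<tau> r k 1 * \<omega> (k - 1) + wsbdf2_kernel \<theta> \<tau> r k 0 * \<omega> k"
    using assms by simp
  also have "\<dots> = ((1 - 2 * \<theta>) * (r k)\<^sup>2 * \<omega> (k - 1) + (1 + 2 * \<theta> * r k) * \<omega> k)
      / (\<tau> k * (1 + r k))"
    using assms by (simp add: wsbdf2_kernel_def add_divide_distrib distrib_right)
  finally show ?thesis by (simp add: algebra_simps)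
qed

lemma wsbdf2_local_bound:
  assumes \<theta>: "1/2 \<le> \<theta>" and k: "2 \<le> k" and pos: "0 < \<tau> k" "0 < \<tau> (k - 1)"
    and r: "r k = \<tau> k / \<tau> (k - 1)"
    and w: "ratio_weight \<theta> (r k) + W \<le> 2 * (1 + 2 * \<theta> * r k) / (1 + r k)"
  shows "W * ((\<omega> k)\<^sup>2 / \<tau> k) - ratio_weight \<theta> (r k) * ((\<omega> (k - 1))\<^sup>2 / \<tau> (k - 1))
    \<le> 2 * \<omega> k * (\<Sum>j=1..k. wsbdf2_kernel \<theta> \<tau> r k (k - j) * \<omega> j)"
proof -
  define x a b V where "x = r k" and "a = \<omega> k" and "b = \<omega> (k - 1)" and "V = ratio_weight \<theta> x"
  have x: "0 < x" using pos r by (simp add: x_def)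
  have "(2 * \<theta> - 1) * (2 * x\<^sup>2 * (a * b)) \<le> (2 * \<theta> - 1) * (x powr (3/2) * (a\<^sup>2 + x * b\<^sup>2))"
    using \<theta> x by (intro mult_left_mono weighted_young) auto
  then have "(2 * \<theta> - 1) * (2 * x\<^sup>2 * (a * b)) / (1 + x)
      \<le> (2 * \<theta> - 1) * (x powr (3/2) * (a\<^sup>2 + x * b\<^sup>2)) / (1 + x)"
    using x by (intro divide_right_mono) auto
  then have cross: "(2 * \<theta> - 1) * (2 * x\<^sup>2 * (a * b)) / (1 + x) \<le> V * (a\<^sup>2 + x * b\<^sup>2)"
    by (simp add: V_def ratio_weight_def mult.assoc)
  have "(V + W) * a\<^sup>2 \<le> 2 * (1 + 2 * \<theta> * x) / (1 + x) * a\<^sup>2"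
    using w by (intro mult_right_mono) (auto simp: V_def x_def)
  with cross have "W * a\<^sup>2 - V * (x * b\<^sup>2)
      \<le> 2 * (1 + 2 * \<theta> * x) / (1 + x) * a\<^sup>2 - (2 * \<theta> - 1) * (2 * x\<^sup>2 * (a * b)) / (1 + x)"
    by (simp add: algebra_simps)
  also have "\<dots> = 2 * a * ((1 + 2 * \<theta> * x) * a - (2 * \<theta> - 1) * x\<^sup>2 * b) / (1 + x)"
    by (simp add: diff_divide_distrib[symmetric] power2_eq_square algebra_simps)
  finally have "(W * a\<^sup>2 - V * (x * b\<^sup>2)) / \<tau> k
      \<le> 2 * a * ((1 + 2 * \<theta> * x) * a - (2 * \<theta> - 1) * x\<^sup>2 * b) / (1 + x) / \<tau> k"
    using pos by (intro divide_right_mono) auto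
  moreover have "(W * a\<^sup>2 - V * (x * b\<^sup>2)) / \<tau> k = W * (a\<^sup>2 / \<tau> k) - V * (b\<^sup>2 / \<tau> (k - 1))"
    using pos r by (simp add: x_def diff_divide_distrib)
  ultimately show ?thesis
    unfolding wsbdf2_sum[OF k] by (simp add: x_def a_def b_def V_def mult.commute)
qed

section \<open>Positive semi-definiteness\<close>

lemma telescoping_lower_bound:
  fixes f g :: "nat \<Rightarrow> real"
  assumes "1 \<le> n" and "g 1 \<le> f 1" and "\<And>k. k \<in> {2..n} \<Longrightarrow> g k - g (k - 1) \<le> f k"
  shows "g n \<le> (\<Sum>k=1..n. f k)"
  using assms
proof (induction n rule: nat_induct_at_least)
  case base
  then show ?case by simp
next
  case (Suc n)
  have "g n \<le> (\<Sum>k=1..n. f k)" using Suc by auto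
  moreover have "g (Suc n) - g n \<le> f (Suc n)" using Suc.prems(2)[of "Suc n"] Suc.hyps by simp
  ultimately show ?case by simp
qed

theorem lemma2p3:
  fixes \<theta> T :: real and N n :: nat and t \<tau> r \<omega> :: "nat \<Rightarrow> real"
  assumes "1/2 \<le> \<theta>" and "\<theta> \<le> 1"
    and "t 0 = 0" and "t N = T"
    and "\<forall>k\<in>{1..N}. t (k - 1) < t k"
    and "\<forall>k\<in>{1..N}. \<tau> k = t k - t (k - 1)"
    and "\<forall>k\<in>{2..N}. r k = \<tau> k / \<tau> (k - 1)"
    and "\<forall>k\<in>{2..N + 1}. 0 < r k \<and> ereal (r k) \<le> ratio_bound \<theta>"
    and "1 \<le> n" and "n \<le> N"
  shows
    "(\<forall>k\<in>{2..n}.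
        2 * \<omega> k * (\<Sum>j=1..k. wsbdf2_kernel \<theta> \<tau> r k (k - j) * \<omega> j)
        \<ge> (2 * \<theta> - 1) * r (k + 1) powr (3/2) / (1 + r (k + 1)) * ((\<omega> k)\<^sup>2 / \<tau> k)
          - (2 * \<theta> - 1) * r k powr (3/2) / (1 + r k) * ((\<omega> (k - 1))\<^sup>2 / \<tau> (k - 1)))
     \<and> (\<Sum>k=1..n. \<omega> k * (\<Sum>j=1..k. wsbdf2_kernel \<theta> \<tau> r k (k - j) * \<omega> j)) \<ge> 0"
proof -
  note \<theta> = assms(1,2)
  have \<tau>: "0 < \<tau> k" if "k \<in> {1..N}" for k using assms(5,6) that by simp
  have r: "0 < r k" "ereal (r k) \<le> ratio_bound \<theta>" if "k \<in> {2..N + 1}" for k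
    using assms(8) that by auto
  define S where "S k = (\<Sum>j=1..k. wsbdf2_kernel \<theta> \<tau> r k (k - j) * \<omega> j)" for k
  define g where "g k = ratio_weight \<theta> (r (k + 1)) * ((\<omega> k)\<^sup>2 / \<tau> k)" for k
  have local: "g k - g (k - 1) \<le> 2 * \<omega> k * S k" if k: "k \<in> {2..n}" for k
  proof -
    have "g k - ratio_weight \<theta> (r k) * ((\<omega> (k - 1))\<^sup>2 / \<tau> (k - 1)) \<le> 2 * \<omega> k * S k"
      unfolding g_def S_def
    proof (rule wsbdf2_local_bound)
      show "ratio_weight \<theta> (r k) + ratio_weight \<theta> (r (k + 1)) \<le> 2 * (1 + 2 * \<theta> * r k) / (1 + r k)"
        using k assms(10) by (intro ratio_weight_sum_le \<theta> r) auto
      show "0 < \<tau> (k - 1)" using k assms(10) by (intro \<tau>) auto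
    qed (use k assms(7,10) \<theta> \<tau> in auto)
    then show ?thesis using k by (simp add: g_def)
  qed
  have "g 1 \<le> 2 * ((\<omega> 1)\<^sup>2 / \<tau> 1)"
    unfolding g_def using assms(9,10) \<tau>[of 1] r[of 2] ratio_weight_le_2[OF \<theta>, of "r 2"]
    by (intro mult_right_mono) (auto simp: numeral_2_eq_2)
  then have "g 1 \<le> 2 * \<omega> 1 * S 1"
    by (simp add: S_def wsbdf2_kernel_def power2_eq_square)
  then have "g n \<le> (\<Sum>k=1..n. 2 * \<omega> k * S k)"
    using local assms(9) by (intro telescoping_lower_bound) auto
  moreover have "0 \<le> g n"
    unfolding g_def using assms(9,10) \<theta> \<tau>[of n] r[of "n + 1"] ratio_weight_nonneg[of \<theta> "r (n + 1)"]
    by simp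
  moreover have "(\<Sum>k=1..n. 2 * \<omega> k * S k) = 2 * (\<Sum>k=1..n. \<omega> k * S k)"
    by (simp add: sum_distrib_left mult.assoc)
  ultimately have "0 \<le> (\<Sum>k=1..n. \<omega> k * S k)" by simp
  with local show ?thesis by (auto simp: S_def g_def ratio_weight_def)
qed

end
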